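(* Let $\Gamma \cup \{\varphi\} \subseteq \mathfrak{F}_{\varnothing}$. Then $\Gamma \vdash_{\varnothing} \varphi$ if and only if $\Gamma \vDash_{\mathbf{2}} \varphi$.
   Context: Let $\Pi$ be an infinite set of propositional letters. $\mathfrak{F}_{\varnothing}$ is the set of formulas built from $\Pi$ with no connectives, i.e. $\mathfrak{F}_\varnothing = \Pi$. Derivability $\vdash_{\varnothing}$ is the smallest relation between sets of formulas of $\mathfrak{F}_{\varnothing}$ and formulas of $\mathfrak{F}_{\varnothing}$ satisfying: (R$_\in$) if $\varphi \in \Gamma$, then $\Gamma \vdash \varphi$; (R$_m$) if $\Gamma \vdash \varphi$, then $\Gamma, \psi \vdash \varphi$; (R$_t$) if $\Gamma \vdash \varphi$ and $\Delta, \varphi \vdash \psi$, then $\Gamma, \Delta \vdash \psi$. $\mathbf{2}$ is the algebra with universe $\{0,1\}$ and no operations, with set of designated values $D=\{1\}$. $\Gamma \vDash_{\mathbf{2}} \varphi$ means: for every assignment $v : \Pi \to \{0,1\}$, if $v(\psi) = 1$ for all $\psi \in \Gamma$, then $v(\varphi) = 1$. *)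

theory Defs
  imports Main "HOL-Library.FuncSet"
begin

text \<open>
  The set of propositional letters is an explicit parameter \<open>L\<close>. Over the empty signature
  a formula is just a letter.
\<close>

definition formulas :: "'a set \<Rightarrow> 'a set" where
  "formulas L = L"

text \<open>
  Derivability relates subsets of \<open>formulas L\<close> (possibly infinite) to elements of \<open>formulas L\<close>.
  The side conditions below are those needed to enforce this; the remaining ones follow,
  see \<open>derivable_formulas\<close>.
\<close>

inductive derivable :: "'a set \<Rightarrow> 'a set \<Rightarrow> 'a \<Rightarrow> bool" for L where
  R_in: "\<Gamma> \<subseteq> formulas L \<Longrightarrow> \<phi> \<in> \<Gamma> \<Longrightarrow> derivable L \<Gamma> \<phi>"
| R_m: "derivable L \<Gamma> \<phi> \<Longrightarrow> \<psi> \<in> formulas L \<Longrightarrow> derivable L (\<Gamma> \<union> {\<psi>}) \<phi>"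
| R_t: "derivable L \<Gamma> \<phi> \<Longrightarrow> derivable L (\<Delta> \<union> {\<phi>}) \<psi> \<Longrightarrow> derivable L (\<Gamma> \<union> \<Delta>) \<psi>"

lemma derivable_formulas:
  "derivable L \<Gamma> \<phi> \<Longrightarrow> \<Gamma> \<subseteq> formulas L \<and> \<phi> \<in> formulas L"
  by (induction rule: derivable.induct) auto

definition two :: "nat set" where
  "two = {0, 1}"

definition designated :: "nat set" where
  "designated = {1}"

text \<open>
  The algebra \<open>two\<close> has no operations, so every assignment of values to letters is already
  a valuation of formulas.
\<close>

definition entails :: "'a set \<Rightarrow> 'a set \<Rightarrow> 'a \<Rightarrow> bool" where
  "entails L \<Gamma> \<phi> \<longleftrightarrow>
    (\<forall>v \<in> L \<rightarrow>\<^sub>E two. (\<forall>\<psi>\<in>\<Gamma>. v \<psi> \<in> designated) \<longrightarrow> v \<phi> \<in> designated)"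

end

theory Submission
  imports Defs
begin

text \<open>
  Without connectives, both relations collapse to membership. Each structural rule preserves
  \<open>\<phi> \<in> \<Gamma>\<close>: in a cut, a conclusion that is the cut formula itself already lies in the
  premises from which that formula was derived. Semantically, the letters are independent, so
  the assignment that is 1 exactly on \<open>\<Gamma>\<close> refutes every letter outside \<open>\<Gamma>\<close>. Soundness and
  completeness follow by comparing \<open>derivable_iff_mem\<close> with \<open>entails_iff_mem\<close>.
\<close>

lemma derivable_iff_mem:
  assumes "\<Gamma> \<subseteq> formulas L"
  shows "derivable L \<Gamma> \<phi> \<longleftrightarrow> \<phi> \<in> \<Gamma>"
proof
  show "\<phi> \<in> \<Gamma>" if "derivable L \<Gamma> \<phi>"
    using that by (induction rule: derivable.induct) auto
  show "derivable L \<Gamma> \<phi>" if "\<phi> \<in> \<Gamma>"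
    using assms that by (rule derivable.R_in)
qed

lemma entails_iff_mem:
  assumes "\<Gamma> \<subseteq> L" and "\<phi> \<in> L"
  shows "entails L \<Gamma> \<phi> \<longleftrightarrow> \<phi> \<in> \<Gamma>"
proof
  assume entails: "entails L \<Gamma> \<phi>"
  define v :: "'a \<Rightarrow> nat" where "v = (\<lambda>p\<in>L. if p \<in> \<Gamma> then 1 else 0)"
  have "v \<in> L \<rightarrow>\<^sub>E two"
    by (auto simp: v_def two_def)
  moreover have "\<forall>\<psi>\<in>\<Gamma>. v \<psi> \<in> designated"
    using assms(1) by (auto simp: v_def designated_def)
  ultimately have "v \<phi> \<in> designated"
    using entails by (simp add: entails_def)
  then show "\<phi> \<in> \<Gamma>"
    using assms(2) by (simp add: v_def designated_def split: if_splits)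
next
  show "entails L \<Gamma> \<phi>" if "\<phi> \<in> \<Gamma>"
    using that by (simp add: entails_def)
qed

theorem corollary1:
  fixes L :: "'a set" and \<Gamma> :: "'a set" and \<phi> :: 'a
  assumes "infinite L"
    and "\<Gamma> \<union> {\<phi>} \<subseteq> formulas L"
  shows "derivable L \<Gamma> \<phi> \<longleftrightarrow> entails L \<Gamma> \<phi>"
  using assms(2) by (simp add: derivable_iff_mem entails_iff_mem formulas_def)

end
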